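(* Let $R$ be a $v$-coherent domain with quotient field $K$. The following statements are equivalent. (1) $R$ is a $t\#$-domain. (2) For each $N \in t\text{-Max}(R)$, $\bigcap_{M \in t\text{-Max}(R) \setminus \{N\}} R_M \nsubseteq R_N$. (3) For each $N \in t\text{-Max}(R)$, $R \neq \bigcap_{M \in t\text{-Max}(R) \setminus \{N\}} R_M$. (4) $\bigcap_{M \in \mathcal M_1} R_M$ and $\bigcap_{M \in \mathcal M_2} R_M$ are incomparable under inclusion for each pair of disjoint nonempty subsets $\mathcal M_1, \mathcal M_2$ of $t\text{-Max}(R)$. (5) For each maximal $t$-ideal $M$ of $R$, there is a divisorial ideal of $R$ which is contained in $M$ and in no other maximal $t$-ideal of $R$. (6) For each maximal $t$-ideal $M$ of $R$, there is an element $u \in K \setminus R$ such that $M$ is the only maximal $t$-ideal of $R$ containing $(R:_R u)$. (7) Each maximal $t$-ideal of $R$ contains a finitely generated ideal which is contained in no other maximal $t$-ideal of $R$.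
   Context: For a nonzero fractional ideal $I$ of $R$: $I^{-1} = \{x \in K \mid xI \subseteq R\}$, $I_v = (I^{-1})^{-1}$, and $I_t = \bigcup J_v$, the union over all nonzero finitely generated $J \subseteq I$. $I$ is divisorial if $I = I_v$, and a $t$-ideal if $I = I_t$. A maximal $t$-ideal is an ideal maximal among the proper nonzero (integral) $t$-ideals of $R$; $t\text{-Max}(R)$ is the set of maximal $t$-ideals. $(R:_R u) = \{r \in R \mid ru \in R\}$. An intersection of localizations over an empty set of primes is $K$. $R$ is a $t\#$-domain if $\bigcap_{M \in \mathcal M_1} R_M \neq \bigcap_{M \in \mathcal M_2} R_M$ for any two distinct subsets $\mathcal M_1, \mathcal M_2$ of $t\text{-Max}(R)$. $R$ is $v$-coherent if for each nonzero finitely generated ideal $I$ of $R$ there is a finitely generated (fractional) ideal $J$ with $I^{-1} = J_v$. *)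

theory Defs
  imports "HOL-Computational_Algebra.Polynomial_Factorial"
begin

text \<open>
  The domain \<open>R\<close> is (the universe of) a type \<open>'a::idom\<close> and its quotient field \<open>K\<close> is \<open>'a fract\<close>.
  As usual \<open>R\<close> is identified with its image in \<open>K\<close>, so that all ideals, integral or fractional,
  are subsets of \<open>K\<close>.
\<close>

abbreviation base_ring :: "'a::idom fract set" where
  "base_ring \<equiv> range to_fract"

definition fract_scale :: "'a::idom \<Rightarrow> 'a fract \<Rightarrow> 'a fract" where
  "fract_scale r x = to_fract r * x"

global_interpretation fract: module "fract_scale :: 'a::idom \<Rightarrow> 'a fract \<Rightarrow> 'a fract"
  by unfold_locales (simp_all add: fract_scale_def algebra_simps)

definition fractional_ideal :: "'a::idom fract set \<Rightarrow> bool" where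
  "fractional_ideal I \<longleftrightarrow>
     fract.subspace I \<and> (\<exists>d. d \<noteq> 0 \<and> (\<forall>x\<in>I. fract_scale d x \<in> base_ring))"

definition integral_ideal :: "'a::idom fract set \<Rightarrow> bool" where
  "integral_ideal I \<longleftrightarrow> fract.subspace I \<and> I \<subseteq> base_ring"

definition fin_gen :: "'a::idom fract set \<Rightarrow> bool" where
  "fin_gen I \<longleftrightarrow> (\<exists>S. finite S \<and> I = fract.span S)"

definition ideal_inv :: "'a::idom fract set \<Rightarrow> 'a fract set" where
  "ideal_inv I = {x. (\<lambda>y. x * y) ` I \<subseteq> base_ring}"

definition v_closure :: "'a::idom fract set \<Rightarrow> 'a fract set" where
  "v_closure I = ideal_inv (ideal_inv I)"

definition t_closure :: "'a::idom fract set \<Rightarrow> 'a fract set" where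
  "t_closure I =
     \<Union> {v_closure J | J. fractional_ideal J \<and> fin_gen J \<and> J \<noteq> {0} \<and> J \<subseteq> I}"

definition divisorial :: "'a::idom fract set \<Rightarrow> bool" where
  "divisorial I \<longleftrightarrow> fractional_ideal I \<and> I \<noteq> {0} \<and> I = v_closure I"

definition t_ideal :: "'a::idom fract set \<Rightarrow> bool" where
  "t_ideal I \<longleftrightarrow> fractional_ideal I \<and> I \<noteq> {0} \<and> I = t_closure I"

definition proper_integral_t_ideal :: "'a::idom fract set \<Rightarrow> bool" where
  "proper_integral_t_ideal I \<longleftrightarrow> t_ideal I \<and> integral_ideal I \<and> I \<noteq> base_ring"

definition t_Max :: "'a::idom fract set set" where
  "t_Max = {M. proper_integral_t_ideal M \<and>
               (\<forall>I. proper_integral_t_ideal I \<and> M \<subseteq> I \<longrightarrow> I = M)}"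

text \<open>The localization of \<open>R\<close> at \<open>P\<close> inside \<open>K\<close>; meaningful when \<open>P\<close> is a prime ideal, as
  maximal \<open>t\<close>-ideals always are.\<close>

definition localization_at :: "'a::idom fract set \<Rightarrow> 'a fract set" where
  "localization_at P = {a / s | a s. a \<in> base_ring \<and> s \<in> base_ring - P}"

text \<open>\<open>(R :\<^sub>R u)\<close>\<close>

definition denominator_ideal :: "'a::idom fract \<Rightarrow> 'a fract set" where
  "denominator_ideal u = {r \<in> base_ring. r * u \<in> base_ring}"

definition t_sharp_domain :: "'a::idom itself \<Rightarrow> bool" where
  "t_sharp_domain T \<longleftrightarrow>
     (\<forall>\<M>1 \<M>2 :: 'a fract set set. \<M>1 \<subseteq> t_Max \<and> \<M>2 \<subseteq> t_Max \<and> \<M>1 \<noteq> \<M>2 \<longrightarrow>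
        (\<Inter>M\<in>\<M>1. localization_at M) \<noteq> (\<Inter>M\<in>\<M>2. localization_at M))"

definition v_coherent :: "'a::idom itself \<Rightarrow> bool" where
  "v_coherent T \<longleftrightarrow>
     (\<forall>I :: 'a fract set. integral_ideal I \<and> fin_gen I \<and> I \<noteq> {0} \<longrightarrow>
        (\<exists>J. fractional_ideal J \<and> fin_gen J \<and> J \<noteq> {0} \<and> ideal_inv I = v_closure J))"

end

theory Submission
  imports Defs
begin

text \<open>
  Intersections of localizations are controlled by denominator ideals: \<open>u\<close> lies in \<open>R\<^sub>M\<close> exactly
  when \<open>(R :\<^sub>R u)\<close> is not contained in \<open>M\<close>. Since \<open>(R :\<^sub>R u)\<close> is the inverse of the fractional
  ideal generated by \<open>1\<close> and \<open>u\<close>, it is divisorial, hence a \<open>t\<close>-ideal; and by Zorn's lemma every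
  proper integral \<open>t\<close>-ideal lies in a maximal one. So for \<open>u \<notin> R\<close> some maximal \<open>t\<close>-ideal
  contains \<open>(R :\<^sub>R u)\<close>, which means that \<open>R\<close> is the intersection of all the \<open>R\<^sub>M\<close>
  (\<open>Inter_localizations_t_Max\<close>). With this identity, the \<open>t#\<close>-property and the
  three other conditions on intersections of localizations all say that no \<open>R\<^sub>N\<close> may be omitted
  from this representation of \<open>R\<close>.

  An element \<open>u\<close> of all \<open>R\<^sub>M\<close> with \<open>M \<noteq> N\<close>, but not of \<open>R\<^sub>N\<close>, is precisely one for which \<open>N\<close> is the
  only maximal \<open>t\<close>-ideal containing \<open>(R :\<^sub>R u)\<close>, and \<open>(R :\<^sub>R u)\<close> is then a divisorial ideal
  contained in \<open>N\<close> alone. Conversely, let \<open>I\<close> be a divisorial ideal contained in \<open>N\<close> alone. Then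
  \<open>I\<^sup>-\<^sup>1\<close> lies in every other localization; if it also lay in \<open>R\<^sub>N\<close>, it would lie in \<open>R\<close>, which puts \<open>1\<close> in
  \<open>I\<^sub>v = I\<close>.

  The passage between denominator ideals and finitely generated ideals contained in \<open>M\<close> alone is
  where \<open>v\<close>-coherence enters. It makes \<open>(R :\<^sub>R u)\<close> the \<open>v\<close>-closure of a finitely generated ideal, and a \<open>t\<close>-ideal contains such an ideal if and only
  if it contains the closure. In the other direction, for \<open>I\<close> finitely generated, it writes
  \<open>I\<^sub>v\<close> as a finite intersection of denominator ideals, one of which must lie in the prime ideal
  \<open>M\<close> (\<open>t_Max_prime\<close>).
\<close>

section \<open>Submodules of the quotient field\<close>

lemma zero_in_base_ring [simp]: "0 \<in> base_ring"
  by (metis rangeI to_fract_0)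

lemma one_in_base_ring [simp]: "1 \<in> base_ring"
  by (metis rangeI to_fract_1)

lemma base_ring_add: "x \<in> base_ring \<Longrightarrow> y \<in> base_ring \<Longrightarrow> x + y \<in> base_ring"
  by (metis (no_types, lifting) imageE rangeI to_fract_add)

lemma base_ring_mult: "x \<in> base_ring \<Longrightarrow> y \<in> base_ring \<Longrightarrow> x * y \<in> base_ring"
  by (metis (no_types, lifting) imageE rangeI to_fract_mult)

lemma subspace_iff:
  "fract.subspace I \<longleftrightarrow> 0 \<in> I \<and> (\<forall>x\<in>I. \<forall>y\<in>I. x + y \<in> I) \<and> (\<forall>r\<in>base_ring. \<forall>x\<in>I. r * x \<in> I)"
  unfolding fract.subspace_def fract_scale_def by auto

lemma subspace_mult: "fract.subspace I \<Longrightarrow> r \<in> base_ring \<Longrightarrow> x \<in> I \<Longrightarrow> r * x \<in> I"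
  unfolding subspace_iff by blast

lemma subspace_base_ring: "fract.subspace base_ring"
  by (auto simp: subspace_iff intro: base_ring_add base_ring_mult)

lemma subspace_vimage_mult:
  assumes "fract.subspace I" shows "fract.subspace {x. x * a \<in> I}"
  using assms by (auto simp: subspace_iff distrib_right mult.assoc)

lemma subspace_image_mult:
  assumes "fract.subspace I" shows "fract.subspace ((*) a ` I)"
  unfolding subspace_iff
proof (intro conjI ballI)
  show "0 \<in> (*) a ` I"
    using assms by (intro image_eqI[of _ _ 0]) (simp_all add: subspace_iff)
next
  fix x y assume "x \<in> (*) a ` I" "y \<in> (*) a ` I"
  then obtain x' y' where *: "x = a * x'" "x' \<in> I" "y = a * y'" "y' \<in> I" by blast
  then have "x' + y' \<in> I" using assms unfolding subspace_iff by blast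
  then show "x + y \<in> (*) a ` I"
    by (rule image_eqI[rotated]) (simp add: * distrib_left)
next
  fix r x :: "'a fract" assume r: "r \<in> base_ring" and "x \<in> (*) a ` I"
  then obtain x' where *: "x = a * x'" "x' \<in> I" by blast
  show "r * x \<in> (*) a ` I"
    using subspace_mult[OF assms r *(2)] by (rule image_eqI[rotated]) (simp add: *(1) ac_simps)
qed

lemma scale_neq_0:
  assumes "fract.subspace J" "J \<noteq> {0}" "a \<noteq> 0" shows "(*) a ` J \<noteq> {0}"
proof -
  from assms obtain y where "y \<in> J" "y \<noteq> 0"
    unfolding subspace_iff by blast
  then have "a * y \<in> (*) a ` J" "a * y \<noteq> 0"
    using assms(3) by simp_all
  then show ?thesis by blast
qed

lemma integral_ideal_proper_iff:
  assumes "integral_ideal I" shows "I \<noteq> base_ring \<longleftrightarrow> 1 \<notin> I"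
proof -
  have "x \<in> I" if "1 \<in> I" "x \<in> base_ring" for x
    using subspace_mult[of I x 1] assms that by (simp add: integral_ideal_def)
  with assms show ?thesis
    by (auto simp: integral_ideal_def)
qed

lemma fractional_ideal_subset:
  assumes "fractional_ideal I" "fract.subspace J" "J \<subseteq> I" shows "fractional_ideal J"
  using assms unfolding fractional_ideal_def by blast

lemma integral_imp_fractional_ideal: "integral_ideal I \<Longrightarrow> fractional_ideal I"
  unfolding integral_ideal_def fractional_ideal_def
  by (intro conjI exI[of _ 1]) (auto simp: fract_scale_def)

lemma fin_gen_span: "finite S \<Longrightarrow> fin_gen (fract.span S)"
  unfolding fin_gen_def by (intro exI conjI) (assumption, rule refl)

lemma fin_gen_imp_subspace: "fin_gen I \<Longrightarrow> fract.subspace I"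
  by (auto simp: fin_gen_def)

lemma fin_gen_scale:
  assumes "fin_gen J" shows "fin_gen ((*) a ` J)"
proof -
  from assms obtain S where S: "finite S" "J = fract.span S"
    by (auto simp: fin_gen_def)
  have "fract.span S \<subseteq> {x. x * a \<in> fract.span ((*) a ` S)}"
    by (intro fract.span_minimal subspace_vimage_mult fract.subspace_span)
       (auto intro: fract.span_base simp: mult.commute[of _ a])
  moreover have "fract.span ((*) a ` S) \<subseteq> (*) a ` fract.span S"
  proof (rule fract.span_minimal)
    show "(*) a ` S \<subseteq> (*) a ` fract.span S"
      by (auto intro: fract.span_base)
    show "fract.subspace ((*) a ` fract.span S)"
      by (intro subspace_image_mult fract.subspace_span)
  qed
  ultimately have "(*) a ` J = fract.span ((*) a ` S)"
    using S by (auto simp: mult.commute[of _ a])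
  then show ?thesis
    using S(1) by (simp add: fin_gen_span)
qed

lemma common_denominator:
  obtains b where "b \<in> base_ring" "b \<noteq> 0" "b * u \<in> base_ring"
proof -
  obtain p q where "u = Fract p q" "q \<noteq> 0"
    by (cases u)
  then have "to_fract q * u = to_fract p"
    by (simp add: Fract_conv_to_fract)
  then show ?thesis
    using that[of "to_fract q"] \<open>q \<noteq> 0\<close> by auto
qed

section \<open>Inverses and the v-operation\<close>

lemma ideal_inv_iff: "x \<in> ideal_inv I \<longleftrightarrow> (\<forall>y\<in>I. x * y \<in> base_ring)"
  by (auto simp: ideal_inv_def)

lemma ideal_inv_antimono: "I \<subseteq> J \<Longrightarrow> ideal_inv J \<subseteq> ideal_inv I"
  unfolding ideal_inv_def by blast

lemma v_closure_increasing: "I \<subseteq> v_closure I"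
proof
  fix x assume "x \<in> I"
  then have "z * x \<in> base_ring" if "z \<in> ideal_inv I" for z
    using that unfolding ideal_inv_iff by blast
  then show "x \<in> v_closure I"
    unfolding v_closure_def ideal_inv_iff[of x] by (simp only: mult.commute[of x] ball_simps) blast
qed

lemma v_closure_mono: "I \<subseteq> J \<Longrightarrow> v_closure I \<subseteq> v_closure J"
  by (simp add: v_closure_def ideal_inv_antimono)

text \<open>Inversion forms an antitone Galois connection with itself, so three inversions amount to one.\<close>

lemma ideal_inv_v_closure: "ideal_inv (v_closure I) = ideal_inv I"
  using v_closure_increasing[of "ideal_inv I"] ideal_inv_antimono[OF v_closure_increasing[of I]]
  by (auto simp: v_closure_def)

lemma subspace_ideal_inv: "fract.subspace (ideal_inv I)"
  by (auto simp: subspace_iff ideal_inv_iff distrib_right mult.assoc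
      intro: base_ring_add base_ring_mult)

lemma ideal_inv_span: "ideal_inv (fract.span S) = ideal_inv S"
proof
  show "ideal_inv (fract.span S) \<subseteq> ideal_inv S"
    by (intro ideal_inv_antimono) (auto intro: fract.span_base)
next
  show "ideal_inv S \<subseteq> ideal_inv (fract.span S)"
  proof
    fix x assume "x \<in> ideal_inv S"
    then have "fract.span S \<subseteq> {y. y * x \<in> base_ring}"
      by (intro fract.span_minimal subspace_vimage_mult subspace_base_ring)
         (auto simp: ideal_inv_iff mult.commute)
    then show "x \<in> ideal_inv (fract.span S)"
      by (auto simp: ideal_inv_iff mult.commute)
  qed
qed

lemma v_closure_scale:
  assumes "a \<noteq> 0"
  shows "v_closure ((*) a ` J) = (*) a ` v_closure J"
proof -
  have inv: "y \<in> ideal_inv ((*) a ` J) \<longleftrightarrow> a * y \<in> ideal_inv J" for y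
    by (auto simp: ideal_inv_iff ac_simps)
  have "x \<in> v_closure ((*) a ` J) \<longleftrightarrow> x / a \<in> v_closure J" for x
  proof
    assume x: "x \<in> v_closure ((*) a ` J)"
    have "x / a * z \<in> base_ring" if "z \<in> ideal_inv J" for z
      using x that assms inv[of "z / a"] by (auto simp: v_closure_def ideal_inv_iff[of x])
    then show "x / a \<in> v_closure J"
      by (simp add: v_closure_def ideal_inv_iff[of "x / a"])
  next
    assume x: "x / a \<in> v_closure J"
    have "x * y \<in> base_ring" if "y \<in> ideal_inv ((*) a ` J)" for y
    proof -
      have "x / a * (a * y) \<in> base_ring"
        using x that inv[of y] by (simp only: v_closure_def ideal_inv_iff[of "x / a"])
      then show ?thesis using assms by simp
    qed
    then show "x \<in> v_closure ((*) a ` J)"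
      by (simp add: v_closure_def ideal_inv_iff[of x])
  qed
  moreover have "x / a \<in> v_closure J \<longleftrightarrow> x \<in> (*) a ` v_closure J" for x
    using assms by (auto simp: image_iff field_simps intro: bexI[of _ "x / a"])
  ultimately show ?thesis by blast
qed

lemma v_closure_subset_base_ring:
  assumes "I \<subseteq> base_ring" shows "v_closure I \<subseteq> base_ring"
proof
  fix x assume x: "x \<in> v_closure I"
  have "1 \<in> ideal_inv I"
    using assms by (auto simp: ideal_inv_iff)
  with x have "x * 1 \<in> base_ring"
    unfolding v_closure_def ideal_inv_iff[of x] by blast
  then show "x \<in> base_ring" by simp
qed

section \<open>Maximal t-ideals\<close>

text \<open>
  A nonzero ideal is always contained in its \<open>t\<close>-closure, because each nonzero element generates a
  principal ideal.
\<close>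

lemma t_ideal_iff:
  "t_ideal I \<longleftrightarrow> fractional_ideal I \<and> I \<noteq> {0} \<and>
     (\<forall>J. fin_gen J \<and> J \<noteq> {0} \<and> J \<subseteq> I \<longrightarrow> v_closure J \<subseteq> I)"
proof (cases "fractional_ideal I \<and> I \<noteq> {0}")
  case True
  then have sub: "fract.subspace I" by (simp add: fractional_ideal_def)
  have increasing: "x \<in> t_closure I" if x: "x \<in> I" for x
  proof -
    from True sub obtain y where y: "y \<in> I" "y \<noteq> 0"
      by (auto simp: subspace_iff)
    define J where "J = fract.span {x, y}"
    have "J \<subseteq> I"
      unfolding J_def using x y sub by (intro fract.span_minimal) auto
    moreover have "fin_gen J"
      unfolding J_def by (intro fin_gen_span) simp
    moreover have J: "x \<in> J" "y \<in> J"
      by (auto simp: J_def intro: fract.span_base)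
    moreover have "fractional_ideal J"
      using True \<open>fin_gen J\<close> \<open>J \<subseteq> I\<close> by (blast intro: fractional_ideal_subset fin_gen_imp_subspace)
    moreover have "x \<in> v_closure J" "J \<noteq> {0}"
      using J y(2) v_closure_increasing[of J] by blast+
    ultimately show ?thesis
      unfolding t_closure_def by blast
  qed
  have "I = t_closure I \<longleftrightarrow> t_closure I \<subseteq> I"
    using increasing by (simp add: set_eq_subset subset_iff)
  also have "\<dots> \<longleftrightarrow>
      (\<forall>J. fin_gen J \<and> J \<noteq> {0} \<and> J \<subseteq> I \<longrightarrow> v_closure J \<subseteq> I)"
    using True fractional_ideal_subset[of I] fin_gen_imp_subspace
    unfolding t_closure_def by blast
  finally show ?thesis
    using True by (simp add: t_ideal_def)
qed (auto simp: t_ideal_def)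

lemma divisorial_imp_t_ideal: "divisorial I \<Longrightarrow> t_ideal I"
  unfolding t_ideal_iff divisorial_def using v_closure_mono by blast

lemma proper_integral_t_ideal_iff:
  "proper_integral_t_ideal I \<longleftrightarrow> integral_ideal I \<and> I \<noteq> {0} \<and> 1 \<notin> I \<and>
     (\<forall>J. fin_gen J \<and> J \<noteq> {0} \<and> J \<subseteq> I \<longrightarrow> v_closure J \<subseteq> I)"
proof (cases "integral_ideal I")
  case True
  then show ?thesis
    unfolding proper_integral_t_ideal_def t_ideal_iff
    by (simp only: integral_imp_fractional_ideal integral_ideal_proper_iff[OF True]) metis
qed (simp add: proper_integral_t_ideal_def)

lemma t_MaxD:
  assumes "M \<in> t_Max"
  shows "fract.subspace M" "M \<subseteq> base_ring" "M \<noteq> {0}" "1 \<notin> M"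
    and "\<And>J. fin_gen J \<Longrightarrow> J \<noteq> {0} \<Longrightarrow> J \<subseteq> M \<Longrightarrow> v_closure J \<subseteq> M"
  using assms by (auto simp: t_Max_def proper_integral_t_ideal_iff integral_ideal_def)

lemma t_Max_obtain_nonzero:
  assumes "M \<in> t_Max" obtains m where "m \<in> M" "m \<noteq> 0"
  using t_MaxD(1,3)[OF assms] by (auto simp: subspace_iff)

text \<open>
  The \<open>t\<close>-operation has finite type: the finitely many generators of an ideal contained in the union
  of a chain already lie in one member. So unions of chains of \<open>t\<close>-ideals are \<open>t\<close>-ideals and
  Zorn's lemma applies.
\<close>

lemma proper_integral_t_ideal_Union:
  assumes ne: "C \<noteq> {}" and chain: "subset.chain (Collect proper_integral_t_ideal) C"
  shows "proper_integral_t_ideal (\<Union>C)"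
proof -
  have pit: "proper_integral_t_ideal I" if "I \<in> C" for I
    using that chain by (auto simp: subset.chain_def)
  have fin: "\<exists>I\<in>C. S \<subseteq> I" if "finite S" "S \<subseteq> \<Union>C" for S
    using that chain ne by (metis finite_subset_Union_chain)
  have int: "fract.subspace I" "I \<subseteq> base_ring" "I \<noteq> {0}" "1 \<notin> I" if "I \<in> C" for I
    using pit[OF that] by (auto simp: proper_integral_t_ideal_iff integral_ideal_def)
  from ne obtain I0 where I0: "I0 \<in> C" by blast
  have "fract.subspace (\<Union>C)"
    unfolding subspace_iff
  proof (intro conjI ballI)
    show "0 \<in> \<Union>C" using int(1)[OF I0] I0 by (auto simp: subspace_iff)
  next
    fix x y assume "x \<in> \<Union>C" "y \<in> \<Union>C"
    then obtain I where "I \<in> C" "x \<in> I" "y \<in> I"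
      using fin[of "{x, y}"] by auto
    then show "x + y \<in> \<Union>C" using int(1) by (auto simp: subspace_iff)
  next
    fix r x :: "'a fract" assume "r \<in> base_ring" "x \<in> \<Union>C"
    then show "r * x \<in> \<Union>C" using int(1) subspace_mult by blast
  qed
  moreover have "v_closure J \<subseteq> \<Union>C" if J: "fin_gen J" "J \<noteq> {0}" "J \<subseteq> \<Union>C" for J
  proof -
    from J(1) obtain S where S: "finite S" "J = fract.span S"
      by (auto simp: fin_gen_def)
    then have "S \<subseteq> \<Union>C"
      using J(3) fract.span_superset[of S] by blast
    with fin S obtain I where I: "I \<in> C" "S \<subseteq> I" by blast
    then have "J \<subseteq> I"
      unfolding S by (intro fract.span_minimal int)
    with I J pit show ?thesis
      unfolding proper_integral_t_ideal_iff by blast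
  qed
  moreover have "\<Union>C \<noteq> {0}"
    using int(1,3)[OF I0] I0 by (auto simp: subspace_iff)
  moreover have "\<Union>C \<subseteq> base_ring" "1 \<notin> \<Union>C"
    using int(2,4) by blast+
  ultimately show ?thesis
    by (simp add: proper_integral_t_ideal_iff integral_ideal_def)
qed

lemma subset_t_Max:
  assumes "proper_integral_t_ideal I"
  obtains M where "M \<in> t_Max" "I \<subseteq> M"
proof -
  let ?A = "{J. proper_integral_t_ideal J \<and> I \<subseteq> J}"
  have "\<exists>M\<in>?A. \<forall>X\<in>?A. M \<subseteq> X \<longrightarrow> X = M"
  proof (rule subset_Zorn_nonempty)
    show "?A \<noteq> {}" using assms by blast
  next
    fix C assume C: "C \<noteq> {}" "subset.chain ?A C"
    then have "subset.chain (Collect proper_integral_t_ideal) C"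
      by (auto simp: subset.chain_def)
    with C(1) have "proper_integral_t_ideal (\<Union>C)"
      by (rule proper_integral_t_ideal_Union)
    moreover have "I \<subseteq> \<Union>C"
      using C unfolding subset.chain_def by blast
    ultimately show "\<Union>C \<in> ?A" by blast
  qed
  then obtain M where "proper_integral_t_ideal M" "I \<subseteq> M"
      "\<forall>X. proper_integral_t_ideal X \<and> I \<subseteq> X \<longrightarrow> M \<subseteq> X \<longrightarrow> X = M"
    by auto
  then have "M \<in> t_Max" unfolding t_Max_def by blast
  with \<open>I \<subseteq> M\<close> that show ?thesis by blast
qed

text \<open>
  For \<open>a \<notin> M\<close> the ideal \<open>(M :\<^sub>R a)\<close> is proper and contains \<open>M\<close>. It is again a \<open>t\<close>-ideal, since
  scaling by \<open>a\<close> commutes with the \<open>v\<close>-operation, and therefore equals \<open>M\<close>.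
\<close>

lemma t_Max_prime:
  assumes M: "M \<in> t_Max" and a: "a \<in> base_ring" "a \<notin> M" and b: "b \<in> base_ring" and ab: "a * b \<in> M"
  shows "b \<in> M"
proof -
  note D = t_MaxD[OF M]
  define I where "I = {x \<in> base_ring. x * a \<in> M}"
  have "a \<noteq> 0" using a D(1) by (auto simp: subspace_iff)
  have "M \<subseteq> I"
    using D(1,2) a by (auto simp: I_def mult.commute[of _ a] intro: subspace_mult)
  moreover have "proper_integral_t_ideal I"
    unfolding proper_integral_t_ideal_iff
  proof (intro conjI allI impI)
    have "I = base_ring \<inter> {x. x * a \<in> M}" by (auto simp: I_def)
    then show "integral_ideal I"
      unfolding integral_ideal_def
      by (auto intro!: fract.subspace_inter subspace_base_ring subspace_vimage_mult D(1))
    show "I \<noteq> {0}" using \<open>M \<subseteq> I\<close> t_Max_obtain_nonzero[OF M] by blast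
    show "1 \<notin> I" using a by (simp add: I_def)
  next
    fix J assume J: "fin_gen J \<and> J \<noteq> {0} \<and> J \<subseteq> I"
    with \<open>a \<noteq> 0\<close> have "(*) a ` J \<noteq> {0}"
      by (simp add: scale_neq_0 fin_gen_imp_subspace)
    moreover have "(*) a ` J \<subseteq> M"
      using J by (auto simp: I_def mult.commute)
    ultimately have "v_closure ((*) a ` J) \<subseteq> M"
      using J by (intro D(5) fin_gen_scale) auto
    then have "(*) a ` v_closure J \<subseteq> M"
      using \<open>a \<noteq> 0\<close> by (simp add: v_closure_scale)
    moreover have "v_closure J \<subseteq> base_ring"
      using J by (intro v_closure_subset_base_ring) (auto simp: I_def)
    ultimately show "v_closure J \<subseteq> I"
      by (auto simp: I_def mult.commute)
  qed
  ultimately have "I = M" using M by (auto simp: t_Max_def)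
  moreover have "b \<in> I" using ab b by (simp add: I_def mult.commute)
  ultimately show ?thesis by simp
qed

lemma t_Max_prod_notin:
  assumes "M \<in> t_Max" "finite S" "\<And>x. x \<in> S \<Longrightarrow> f x \<in> base_ring - M"
  shows "prod f S \<in> base_ring - M"
  using assms(2,3)
proof (induction S rule: finite_induct)
  case empty
  then show ?case using t_MaxD(4)[OF assms(1)] by simp
next
  case (insert x S)
  then show ?case
    using t_Max_prime[OF assms(1), of "f x" "prod f S"] by (auto intro: base_ring_mult)
qed

section \<open>Denominator ideals and localizations\<close>

lemma denominator_ideal_eq_ideal_inv: "denominator_ideal u = ideal_inv (fract.span {1, u})"
  by (auto simp: denominator_ideal_def ideal_inv_span ideal_inv_iff)

lemma integral_denominator_ideal: "integral_ideal (denominator_ideal u)"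
  using subspace_ideal_inv[of "fract.span {1, u}"]
  by (auto simp: integral_ideal_def denominator_ideal_eq_ideal_inv[symmetric])
     (auto simp: denominator_ideal_def)

lemma divisorial_denominator_ideal: "divisorial (denominator_ideal u)"
proof -
  obtain b where "b \<in> base_ring" "b \<noteq> 0" "b * u \<in> base_ring"
    by (rule common_denominator)
  then have "b \<in> denominator_ideal u" by (simp add: denominator_ideal_def)
  with \<open>b \<noteq> 0\<close> have "denominator_ideal u \<noteq> {0}" by blast
  moreover have "denominator_ideal u = v_closure (denominator_ideal u)"
    unfolding denominator_ideal_eq_ideal_inv
    by (metis ideal_inv_v_closure v_closure_def)
  ultimately show ?thesis
    unfolding divisorial_def
    using integral_imp_fractional_ideal[OF integral_denominator_ideal] by blast
qed

lemma one_in_denominator_ideal_iff: "1 \<in> denominator_ideal u \<longleftrightarrow> u \<in> base_ring"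
  by (simp add: denominator_ideal_def)

lemma denominator_ideal_subset_t_Max:
  assumes "u \<notin> base_ring"
  obtains M where "M \<in> t_Max" "denominator_ideal u \<subseteq> M"
proof -
  have "proper_integral_t_ideal (denominator_ideal u)"
    using assms divisorial_imp_t_ideal[OF divisorial_denominator_ideal]
      integral_denominator_ideal[of u] one_in_denominator_ideal_iff[of u]
    unfolding proper_integral_t_ideal_def by (auto simp: integral_ideal_proper_iff)
  then show ?thesis using that by (rule subset_t_Max)
qed

lemma localization_at_iff:
  assumes "M \<in> t_Max"
  shows "u \<in> localization_at M \<longleftrightarrow> \<not> denominator_ideal u \<subseteq> M"
proof -
  have zero: "0 \<in> M" using t_MaxD(1)[OF assms] by (simp add: subspace_iff)
  have "(\<exists>a s. u = a / s \<and> a \<in> base_ring \<and> s \<in> base_ring - M) \<longleftrightarrow>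
      (\<exists>s. s \<in> base_ring - M \<and> s * u \<in> base_ring)"
  proof (intro iffI; elim exE conjE)
    fix a s assume "u = a / s" "a \<in> base_ring" "s \<in> base_ring - M"
    moreover have "s \<noteq> 0" using calculation(3) zero by blast
    ultimately show "\<exists>s. s \<in> base_ring - M \<and> s * u \<in> base_ring"
      by (intro exI[of _ s] conjI) simp_all
  next
    fix s assume s: "s \<in> base_ring - M" "s * u \<in> base_ring"
    then have "s \<noteq> 0" using zero by blast
    then have "u = s * u / s" by simp
    with s show "\<exists>a s. u = a / s \<and> a \<in> base_ring \<and> s \<in> base_ring - M" by blast
  qed
  then show ?thesis
    unfolding localization_at_def denominator_ideal_def mem_Collect_eq by blast
qed

lemma base_ring_subset_localization_at:
  assumes "M \<in> t_Max" shows "base_ring \<subseteq> localization_at M"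
  using t_MaxD(4)[OF assms] one_in_denominator_ideal_iff
  unfolding subset_iff[of base_ring] localization_at_iff[OF assms] by blast

lemma Inter_localizations_t_Max: "(\<Inter>M\<in>t_Max. localization_at M) = base_ring"
proof
  show "(\<Inter>M\<in>t_Max. localization_at M) \<subseteq> base_ring"
  proof
    fix u assume u: "u \<in> (\<Inter>M\<in>t_Max. localization_at M)"
    show "u \<in> base_ring"
    proof (rule ccontr)
      assume "u \<notin> base_ring"
      then obtain M where "M \<in> t_Max" "denominator_ideal u \<subseteq> M"
        by (rule denominator_ideal_subset_t_Max)
      with u show False by (auto simp: localization_at_iff)
    qed
  qed
qed (use base_ring_subset_localization_at in blast)

text \<open>For a single maximal \<open>t\<close>-ideal the empty intersection \<open>K\<close> is not contained in \<open>R\<^sub>N\<close>.\<close>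

lemma localization_at_neq_UNIV:
  assumes "N \<in> t_Max" shows "localization_at N \<noteq> UNIV"
proof -
  obtain m where m: "m \<in> N" "m \<noteq> 0" using t_Max_obtain_nonzero[OF assms] .
  have "s \<in> N" if "s \<in> base_ring" "s * (1 / m) \<in> base_ring" for s
    using subspace_mult[OF t_MaxD(1)[OF assms] that(2) m(1)] m(2) by simp
  then have "1 / m \<notin> localization_at N"
    by (auto simp: localization_at_iff[OF assms] denominator_ideal_def)
  then show ?thesis by blast
qed

lemma ideal_inv_subset_localization_at:
  assumes "N \<in> t_Max" "I \<subseteq> base_ring" "\<not> I \<subseteq> N"
  shows "ideal_inv I \<subseteq> localization_at N"
proof
  fix x assume "x \<in> ideal_inv I"
  then have "I \<subseteq> denominator_ideal x"
    using assms(2) unfolding ideal_inv_iff denominator_ideal_def by (auto simp: mult.commute[of x])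
  with assms(3) show "x \<in> localization_at N"
    unfolding localization_at_iff[OF assms(1)] by blast
qed

section \<open>Denominator ideals in a v-coherent domain\<close>

text \<open>
  Clearing denominators makes the fractional ideal generated by \<open>1\<close> and \<open>u\<close> integral, so that
  \<open>v\<close>-coherence applies to it.
\<close>

lemma v_coherent_denominator_ideal:
  assumes "v_coherent TYPE('a::idom)"
  obtains J where "fin_gen J" "J \<noteq> {0}" "denominator_ideal (u :: 'a fract) = v_closure J"
proof -
  obtain b where b: "b \<in> base_ring" "b \<noteq> 0" "b * u \<in> base_ring"
    by (rule common_denominator)
  define I where "I = fract.span {b, b * u}"
  have "I \<subseteq> base_ring"
    unfolding I_def using b by (intro fract.span_minimal subspace_base_ring) auto
  moreover have "b \<in> I" by (auto simp: I_def intro: fract.span_base)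
  moreover have "fract.subspace I" "fin_gen I" by (simp_all add: I_def fin_gen_span)
  ultimately obtain J where J: "fin_gen J" "J \<noteq> {0}" "ideal_inv I = v_closure J"
    using assms b(2) unfolding v_coherent_def integral_ideal_def by (metis singletonD)
  have "denominator_ideal u = (*) b ` ideal_inv I"
  proof -
    have *: "x \<in> ideal_inv I \<longleftrightarrow> b * x \<in> denominator_ideal u" for x
      by (auto simp: I_def ideal_inv_span ideal_inv_iff denominator_ideal_def ac_simps)
    have "x \<in> (*) b ` ideal_inv I" if "x \<in> denominator_ideal u" for x
      using that b(2) *[of "x / b"] by (intro image_eqI[of _ _ "x / b"]) auto
    with * show ?thesis by auto
  qed
  then have "denominator_ideal u = v_closure ((*) b ` J)"
    using b(2) J(3) by (simp add: v_closure_scale)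
  moreover have "(*) b ` J \<noteq> {0}"
    using J b(2) by (simp add: scale_neq_0 fin_gen_imp_subspace)
  ultimately show ?thesis
    using that J(1) fin_gen_scale by blast
qed

text \<open>
  By \<open>v\<close>-coherence \<open>I\<^sub>v = J\<^sup>-\<^sup>1\<close> for a finitely generated \<open>J\<close>, and \<open>J\<^sup>-\<^sup>1\<close> is the intersection of the
  denominator ideals of the generators of \<open>J\<close>. If none of these were contained in \<open>M\<close>, a product
  of elements outside \<open>M\<close> would lie in \<open>I\<^sub>v \<subseteq> M\<close>, against primality.
\<close>

lemma v_coherent_fin_gen_subset_denominator_ideal:
  assumes "v_coherent TYPE('a::idom)"
    and M: "M \<in> (t_Max :: 'a fract set set)"
    and I: "integral_ideal I" "fin_gen I" "I \<noteq> {0}" "I \<subseteq> M"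
  obtains u where "I \<subseteq> denominator_ideal u" "denominator_ideal u \<subseteq> M"
proof -
  from assms I obtain J where "fin_gen J" "ideal_inv I = v_closure J"
    unfolding v_coherent_def by blast
  then obtain S where S: "finite S" "ideal_inv I = v_closure (fract.span S)"
    by (auto simp: fin_gen_def)
  have vI: "v_closure I = ideal_inv S"
    by (simp add: v_closure_def[of I] S(2) ideal_inv_v_closure ideal_inv_span)
  have "v_closure I \<subseteq> M"
    using t_MaxD(5)[OF M] I by blast
  have "\<exists>u\<in>S. denominator_ideal u \<subseteq> M"
  proof (rule ccontr)
    assume "\<not> ?thesis"
    then have "\<forall>u\<in>S. \<exists>r. r \<in> denominator_ideal u - M" by blast
    then obtain f where f: "\<And>u. u \<in> S \<Longrightarrow> f u \<in> denominator_ideal u - M" by metis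
    then have f': "f u \<in> base_ring - M" if "u \<in> S" for u
      using that by (auto simp: denominator_ideal_def)
    have "prod f S * u \<in> base_ring" if "u \<in> S" for u
    proof -
      have "prod f (S - {u}) \<in> base_ring"
        using t_Max_prod_notin[OF M, of "S - {u}" f] S(1) f' by blast
      moreover have "f u * u \<in> base_ring"
        using f[OF that] by (simp add: denominator_ideal_def)
      ultimately have "prod f (S - {u}) * (f u * u) \<in> base_ring"
        by (rule base_ring_mult)
      then show ?thesis
        by (simp only: prod.remove[OF S(1) that, of f] ac_simps)
    qed
    then have "prod f S \<in> v_closure I"
      by (simp add: vI ideal_inv_iff)
    moreover have "prod f S \<in> base_ring - M"
      using M S(1) f' by (rule t_Max_prod_notin)
    ultimately show False
      using \<open>v_closure I \<subseteq> M\<close> by blast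
  qed
  then obtain u where u: "u \<in> S" "denominator_ideal u \<subseteq> M" by blast
  have "I \<subseteq> denominator_ideal u"
    using v_closure_increasing[of I] I(1) u(1)
    unfolding vI ideal_inv_def denominator_ideal_def integral_ideal_def by blast
  with u(2) that show ?thesis by blast
qed

section \<open>The characterizations\<close>

lemma t_sharp_domain_iff_not_subset:
  "t_sharp_domain TYPE('a::idom) \<longleftrightarrow>
     (\<forall>N \<in> (t_Max :: 'a fract set set).
        \<not> (\<Inter>M \<in> t_Max - {N}. localization_at M) \<subseteq> localization_at N)" (is "?L \<longleftrightarrow> ?R")
proof
  assume L: ?L
  show ?R
  proof (intro ballI notI)
    fix N :: "'a fract set"
    assume N: "N \<in> t_Max" "(\<Inter>M \<in> t_Max - {N}. localization_at M) \<subseteq> localization_at N"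
    then have "(\<Inter>M \<in> t_Max - {N}. localization_at M) = (\<Inter>M \<in> t_Max. localization_at M)"
      by blast
    moreover have "t_Max - {N} \<noteq> t_Max" using N(1) by blast
    ultimately show False
      using L unfolding t_sharp_domain_def by (metis Diff_subset subset_refl)
  qed
next
  assume R: ?R
  have *: False if "\<M>1 \<subseteq> t_Max" "N \<in> t_Max" "N \<in> \<M>2" "N \<notin> \<M>1"
    "(\<Inter>M\<in>\<M>1. localization_at M) = (\<Inter>M\<in>\<M>2. localization_at M)"
    for \<M>1 \<M>2 :: "'a fract set set" and N
  proof -
    have "(\<Inter>M \<in> t_Max - {N}. localization_at M) \<subseteq> (\<Inter>M\<in>\<M>1. localization_at M)"
      using that(1,4) by blast
    also have "\<dots> \<subseteq> localization_at N" using that(3,5) by blast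
    finally show False using R that(2) by blast
  qed
  show ?L
    unfolding t_sharp_domain_def
  proof (intro allI impI notI)
    fix \<M>1 \<M>2 :: "'a fract set set"
    assume h: "\<M>1 \<subseteq> t_Max \<and> \<M>2 \<subseteq> t_Max \<and> \<M>1 \<noteq> \<M>2"
      and eq: "(\<Inter>M\<in>\<M>1. localization_at M) = (\<Inter>M\<in>\<M>2. localization_at M)"
    then consider N where "N \<in> \<M>2" "N \<notin> \<M>1" | N where "N \<in> \<M>1" "N \<notin> \<M>2" by blast
    then show False
    proof cases
      case 1
      then show False using *[of \<M>1 N \<M>2] h eq by blast
    next
      case 2
      then show False using *[of \<M>2 N \<M>1] h eq by blast
    qed
  qed
qed

lemma not_subset_iff_base_ring_neq:
  assumes "N \<in> t_Max"
  shows "\<not> (\<Inter>M \<in> t_Max - {N}. localization_at M) \<subseteq> localization_at N \<longleftrightarrow>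
     base_ring \<noteq> (\<Inter>M \<in> t_Max - {N}. localization_at M)"
proof -
  have "base_ring = (\<Inter>M \<in> t_Max - {N}. localization_at M) \<inter> localization_at N"
    unfolding Inter_localizations_t_Max[symmetric] using assms by blast
  then show ?thesis by (simp only: inf.absorb_iff1)
qed

lemma all_not_subset_iff_incomparable:
  "(\<forall>N \<in> (t_Max :: 'a::idom fract set set).
      \<not> (\<Inter>M \<in> t_Max - {N}. localization_at M) \<subseteq> localization_at N) \<longleftrightarrow>
   (\<forall>\<M>1 \<M>2 :: 'a fract set set.
      \<M>1 \<subseteq> t_Max \<and> \<M>2 \<subseteq> t_Max \<and> \<M>1 \<noteq> {} \<and> \<M>2 \<noteq> {} \<and> \<M>1 \<inter> \<M>2 = {} \<longrightarrow>
      \<not> (\<Inter>M \<in> \<M>1. localization_at M) \<subseteq> (\<Inter>M \<in> \<M>2. localization_at M) \<and>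
      \<not> (\<Inter>M \<in> \<M>2. localization_at M) \<subseteq> (\<Inter>M \<in> \<M>1. localization_at M))"
  (is "?L \<longleftrightarrow> ?R")
proof
  assume L: ?L
  have *: "\<not> (\<Inter>M \<in> \<M>1. localization_at M) \<subseteq> (\<Inter>M \<in> \<M>2. localization_at M)"
    if h: "\<M>1 \<subseteq> t_Max" "\<M>2 \<subseteq> t_Max" "\<M>2 \<noteq> {}" "\<M>1 \<inter> \<M>2 = {}"
    for \<M>1 \<M>2 :: "'a fract set set"
  proof
    assume sub: "(\<Inter>M \<in> \<M>1. localization_at M) \<subseteq> (\<Inter>M \<in> \<M>2. localization_at M)"
    from h obtain N where N: "N \<in> \<M>2" "N \<in> t_Max" "N \<notin> \<M>1" by blast
    have "(\<Inter>M \<in> t_Max - {N}. localization_at M) \<subseteq> (\<Inter>M \<in> \<M>1. localization_at M)"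
      using h(1) N(3) by blast
    also have "\<dots> \<subseteq> localization_at N" using sub N(1) by blast
    finally show False using L N(2) by blast
  qed
  show ?R
  proof (intro allI impI conjI; elim conjE)
    fix \<M>1 \<M>2 :: "'a fract set set"
    assume h: "\<M>1 \<subseteq> t_Max" "\<M>2 \<subseteq> t_Max" "\<M>1 \<noteq> {}" "\<M>2 \<noteq> {}" "\<M>1 \<inter> \<M>2 = {}"
    show "\<not> (\<Inter>M \<in> \<M>1. localization_at M) \<subseteq> (\<Inter>M \<in> \<M>2. localization_at M)"
      using h by (intro *)
    show "\<not> (\<Inter>M \<in> \<M>2. localization_at M) \<subseteq> (\<Inter>M \<in> \<M>1. localization_at M)"
      using h by (intro *) auto
  qed
next
  assume R: ?R
  show ?L
  proof
    fix N :: "'a fract set" assume N: "N \<in> t_Max"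
    show "\<not> (\<Inter>M \<in> t_Max - {N}. localization_at M) \<subseteq> localization_at N"
    proof (cases "t_Max - {N} = {}")
      case True
      then show ?thesis using localization_at_neq_UNIV[OF N] by auto
    next
      case False
      then show ?thesis using R[rule_format, of "t_Max - {N}" "{N}"] N by auto
    qed
  qed
qed

lemma not_subset_iff_ex_denominator_ideal:
  assumes "N \<in> t_Max"
  shows "\<not> (\<Inter>M \<in> t_Max - {N}. localization_at M) \<subseteq> localization_at N \<longleftrightarrow>
     (\<exists>u. u \<notin> base_ring \<and> denominator_ideal u \<subseteq> N \<and>
          (\<forall>M \<in> t_Max. denominator_ideal u \<subseteq> M \<longrightarrow> M = N))"
proof -
  have notin: "u \<notin> base_ring" if "denominator_ideal u \<subseteq> N" for u
    using that t_MaxD(4)[OF assms] one_in_denominator_ideal_iff[of u] by blast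
  have "\<not> (\<Inter>M \<in> t_Max - {N}. localization_at M) \<subseteq> localization_at N \<longleftrightarrow>
      (\<exists>u. u \<notin> localization_at N \<and> (\<forall>M \<in> t_Max. u \<notin> localization_at M \<longrightarrow> M = N))"
    by blast
  also have "\<dots> \<longleftrightarrow> (\<exists>u. denominator_ideal u \<subseteq> N \<and>
      (\<forall>M \<in> t_Max. denominator_ideal u \<subseteq> M \<longrightarrow> M = N))"
    using assms by (simp add: localization_at_iff cong: ball_cong)
  finally show ?thesis
    using notin by metis
qed

lemma ex_denominator_ideal_iff_ex_divisorial:
  assumes "N \<in> t_Max"
  shows "(\<exists>u. u \<notin> base_ring \<and> denominator_ideal u \<subseteq> N \<and>
          (\<forall>M \<in> t_Max. denominator_ideal u \<subseteq> M \<longrightarrow> M = N)) \<longleftrightarrow>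
     (\<exists>I. divisorial I \<and> integral_ideal I \<and> I \<subseteq> N \<and> (\<forall>M \<in> t_Max. I \<subseteq> M \<longrightarrow> M = N))"
    (is "?L \<longleftrightarrow> ?R")
proof
  assume ?L
  then show ?R
    using divisorial_denominator_ideal integral_denominator_ideal by blast
next
  assume ?R
  then obtain I where I: "divisorial I" "integral_ideal I" "I \<subseteq> N"
    "\<And>M. M \<in> t_Max \<Longrightarrow> I \<subseteq> M \<Longrightarrow> M = N" by blast
  have "ideal_inv I \<subseteq> localization_at M" if "M \<in> t_Max - {N}" for M
    using that I by (intro ideal_inv_subset_localization_at) (auto simp: integral_ideal_def)
  then have others: "ideal_inv I \<subseteq> (\<Inter>M \<in> t_Max - {N}. localization_at M)" by blast
  have "\<not> (\<Inter>M \<in> t_Max - {N}. localization_at M) \<subseteq> localization_at N"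
  proof
    assume "(\<Inter>M \<in> t_Max - {N}. localization_at M) \<subseteq> localization_at N"
    with others have "ideal_inv I \<subseteq> (\<Inter>M \<in> t_Max. localization_at M)" by blast
    then have "ideal_inv I \<subseteq> base_ring" unfolding Inter_localizations_t_Max .
    then have "1 \<in> v_closure I"
      unfolding v_closure_def ideal_inv_iff[of 1] mult_1 by blast
    then have "1 \<in> I" using I(1) by (simp add: divisorial_def)
    then show False using I(3) t_MaxD(4)[OF assms] by blast
  qed
  then show ?L unfolding not_subset_iff_ex_denominator_ideal[OF assms] .
qed

lemma ex_denominator_ideal_iff_ex_fin_gen:
  assumes vc: "v_coherent TYPE('a::idom)" and M: "M \<in> (t_Max :: 'a fract set set)"
  shows "(\<exists>u. u \<notin> base_ring \<and> denominator_ideal u \<subseteq> M \<and>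
          (\<forall>N \<in> t_Max. denominator_ideal u \<subseteq> N \<longrightarrow> N = M)) \<longleftrightarrow>
     (\<exists>I. integral_ideal I \<and> fin_gen I \<and> I \<subseteq> M \<and> (\<forall>N \<in> t_Max. I \<subseteq> N \<longrightarrow> N = M))"
    (is "?L \<longleftrightarrow> ?R")
proof
  assume ?L
  then obtain u where u: "denominator_ideal u \<subseteq> M"
    "\<And>N. N \<in> t_Max \<Longrightarrow> denominator_ideal u \<subseteq> N \<Longrightarrow> N = M" by metis
  obtain J where J: "fin_gen J" "J \<noteq> {0}" "denominator_ideal u = v_closure J"
    using v_coherent_denominator_ideal[OF vc] .
  have "J \<subseteq> M" using u(1) J(3) v_closure_increasing[of J] by blast
  moreover have "integral_ideal J"
    using \<open>J \<subseteq> M\<close> t_MaxD(2)[OF M] fin_gen_imp_subspace[OF J(1)] by (auto simp: integral_ideal_def)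
  moreover have "N = M" if "N \<in> t_Max" "J \<subseteq> N" for N
    using u(2)[OF that(1)] t_MaxD(5)[OF that(1) J(1,2) that(2)] J(3) by simp
  ultimately show ?R using J(1) by blast
next
  assume ?R
  then obtain I0 where I0: "integral_ideal I0" "fin_gen I0" "I0 \<subseteq> M"
    "\<And>N. N \<in> t_Max \<Longrightarrow> I0 \<subseteq> N \<Longrightarrow> N = M" by blast
  \<comment> \<open>\<open>I0\<close> may be zero, but only when \<open>M\<close> is the sole maximal \<open>t\<close>-ideal; enlarging \<open>I0\<close> by a
      nonzero element of \<open>M\<close> covers this case too.\<close>
  obtain m where m: "m \<in> M" "m \<noteq> 0" using t_Max_obtain_nonzero[OF M] .
  from I0(2) obtain S where S: "finite S" "I0 = fract.span S" by (auto simp: fin_gen_def)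
  define I where "I = fract.span (insert m S)"
  have "I0 \<subseteq> I" unfolding S(2) I_def by (intro fract.span_mono) blast
  have "m \<in> I" by (auto simp: I_def intro: fract.span_base)
  with m(2) have "I \<noteq> {0}" by blast
  have "I \<subseteq> M"
    unfolding I_def using m(1) I0(3) S(2) fract.span_superset[of S] t_MaxD(1)[OF M]
    by (intro fract.span_minimal) auto
  have "fin_gen I" using S(1) by (simp add: I_def fin_gen_span)
  have "integral_ideal I"
    using \<open>I \<subseteq> M\<close> t_MaxD(2)[OF M] by (auto simp: integral_ideal_def I_def)
  obtain u where u: "I \<subseteq> denominator_ideal u" "denominator_ideal u \<subseteq> M"
    using v_coherent_fin_gen_subset_denominator_ideal[OF vc M] \<open>integral_ideal I\<close> \<open>fin_gen I\<close>
      \<open>I \<noteq> {0}\<close> \<open>I \<subseteq> M\<close> by blast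
  have "u \<notin> base_ring"
    using u(2) t_MaxD(4)[OF M] one_in_denominator_ideal_iff[of u] by blast
  with u I0(4) \<open>I0 \<subseteq> I\<close> show ?L by blast
qed

theorem theorem1p6:
  assumes "v_coherent TYPE('a::idom)"
  shows
    "(t_sharp_domain TYPE('a) \<longleftrightarrow>
        (\<forall>N \<in> (t_Max :: 'a fract set set).
           \<not> (\<Inter>M \<in> t_Max - {N}. localization_at M) \<subseteq> localization_at N)) \<and>
     (t_sharp_domain TYPE('a) \<longleftrightarrow>
        (\<forall>N \<in> (t_Max :: 'a fract set set).
           base_ring \<noteq> (\<Inter>M \<in> t_Max - {N}. localization_at M))) \<and>
     (t_sharp_domain TYPE('a) \<longleftrightarrow>
        (\<forall>\<M>1 \<M>2 :: 'a fract set set.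
           \<M>1 \<subseteq> t_Max \<and> \<M>2 \<subseteq> t_Max \<and> \<M>1 \<noteq> {} \<and> \<M>2 \<noteq> {} \<and> \<M>1 \<inter> \<M>2 = {} \<longrightarrow>
           \<not> (\<Inter>M \<in> \<M>1. localization_at M) \<subseteq> (\<Inter>M \<in> \<M>2. localization_at M) \<and>
           \<not> (\<Inter>M \<in> \<M>2. localization_at M) \<subseteq> (\<Inter>M \<in> \<M>1. localization_at M))) \<and>
     (t_sharp_domain TYPE('a) \<longleftrightarrow>
        (\<forall>M \<in> (t_Max :: 'a fract set set).
           \<exists>I. divisorial I \<and> integral_ideal I \<and> I \<subseteq> M \<and>
               (\<forall>N \<in> t_Max. I \<subseteq> N \<longrightarrow> N = M))) \<and>
     (t_sharp_domain TYPE('a) \<longleftrightarrow>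
        (\<forall>M \<in> (t_Max :: 'a fract set set).
           \<exists>u. u \<notin> base_ring \<and> denominator_ideal u \<subseteq> M \<and>
               (\<forall>N \<in> t_Max. denominator_ideal u \<subseteq> N \<longrightarrow> N = M))) \<and>
     (t_sharp_domain TYPE('a) \<longleftrightarrow>
        (\<forall>M \<in> (t_Max :: 'a fract set set).
           \<exists>I. integral_ideal I \<and> fin_gen I \<and> I \<subseteq> M \<and>
               (\<forall>N \<in> t_Max. I \<subseteq> N \<longrightarrow> N = M)))"
  using t_sharp_domain_iff_not_subset[where ?'a = 'a] not_subset_iff_base_ring_neq[where ?'a = 'a]
    all_not_subset_iff_incomparable[where ?'a = 'a]
    not_subset_iff_ex_denominator_ideal[where ?'a = 'a]
    ex_denominator_ideal_iff_ex_divisorial[where ?'a = 'a]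
    ex_denominator_ideal_iff_ex_fin_gen[OF assms]
  by (intro conjI) (simp_all cong: ball_cong)

end
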